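(* Let $M$ be a non-singular CM matrix for $S=\{1,\ldots,N\}$, set $A=M-\mathbf{1}$ (with $\mathbf{1}$ the identity matrix), and let $\lambda_K=M_{KK}$ for $K\subseteq S$ denote the eigenvalues of $M$. Then $M$ has a real logarithm $R=\log(\mathbf{1}+A)=\sum_{k=1}^{\infty}\frac{(-1)^{k-1}}{k}A^k$, which has Property CG with the real parameter vector $r=(r_K)_{\varnothing\neq K\subseteq S}$ given by $$ r_K \,=\, \sum_{\varnothing\neq H\supseteq\overline{K}}(-1)^{|H\setminus\overline{K}|}\,\mu_{\overline{H}}\,,\qquad \text{where } \mu_I=\log(\lambda_I). $$ This $R$ is a Markov generator if and only if all entries of $r$ are non-negative, in which case $M$ is embeddable. Further, when $M$ has simple spectrum (all eigenvalues distinct), $R$ is the only real logarithm of $M$, and $M$ is embeddable into a Markov semigroup if and only if $R$ is a Markov generator.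
   Context: Fix $N\in\mathbb{N}$ and $S=\{1,\ldots,N\}$. All matrices are real, of size $2^N\times 2^N$, indexed by the subsets of $S$; empty sums are zero; $\overline{K}=S\setminus K$. In the formula for $r_K$, the sum runs over the sets $H\subseteq S$ satisfying the stated conditions. CM matrix: $M$ is a CM matrix if there is a probability vector $p=(p_K)_{K\subseteq S}$ (all $p_K\geqslant 0$, $\sum_{K\subseteq S}p_K=1$) such that $M_{IJ}=\sum_{K\subseteq S:\, I\cup K=J}p_K$ for all $I,J\subseteq S$. Such a matrix satisfies $M_{IJ}=0$ unless $I\subseteq J$, so its eigenvalues, with multiplicities, are its diagonal elements $M_{KK}=\sum_{I\subseteq K}p_I$. Property CG (preliminary form): a matrix $B$ with $B_{IJ}=0$ whenever $I\not\subseteq J$ and with zero row sums has Property CG with parameter vector $r=(r_K)_{\varnothing\neq K\subseteq S}$, a real vector of dimension $2^{|S|}-1$, if $B_{IJ}=\sum_{K:\, I\cup K=J}r_K$ for all $I\neq J$ and $B_{II}=-\sum_{J\supsetneq I}B_{IJ}$ for all $I\subseteq S$. A Markov generator is a real square matrix with non-negative off-diagonal entries and zero row sums. $M$ is embeddable (into a Markov semigroup) if $M=\mathrm{e}^{Q}$ for some Markov generator $Q$. A real logarithm of $M$ is a real matrix $R$ with $M=\mathrm{e}^R$. *)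

theory Defs
  imports "HOL-Analysis.Analysis"
begin

text \<open>
  The ground set \<open>S = {1,...,N}\<close> is \<open>UNIV\<close> of an arbitrary finite type \<open>'s\<close> (so \<open>N = CARD('s)\<close>), and a
  matrix indexed by the subsets of \<open>S\<close> has type \<^typ>\<open>real^('s set)^('s set)\<close>, of size \<open>2^N\<close>.
  The complement of \<open>K\<close> in \<open>S\<close> is \<open>- K\<close>.
\<close>

text \<open>The type of square matrices is not a Banach algebra with respect to \<open>**\<close> in the library
  (and \<open>*\<close> on vectors is componentwise), so \<open>exp\<close> and \<open>^\<close> are not available for it.\<close>

primrec mat_pow :: "real^'n^'n \<Rightarrow> nat \<Rightarrow> real^'n^'n" where
  "mat_pow A 0 = mat 1"
| "mat_pow A (Suc k) = A ** mat_pow A k"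

definition mat_exp :: "real^'n^'n \<Rightarrow> real^'n^'n" where
  "mat_exp Q = (\<Sum>k. (1 / fact k) *\<^sub>R mat_pow Q k)"

lemma mat_pow_entry_bound:
  fixes A :: "real^'n^'n"
  shows "\<bar>mat_pow A k $ i $ j\<bar> \<le> (\<Sum>i\<in>UNIV. \<Sum>j\<in>UNIV. \<bar>A $ i $ j\<bar>) ^ k" (is "_ \<le> ?c ^ k")
proof (induction k arbitrary: i)
  case 0
  then show ?case by (simp add: mat_def)
next
  case (Suc k)
  have c: "0 \<le> ?c" by (intro sum_nonneg) auto
  have "\<bar>mat_pow A (Suc k) $ i $ j\<bar> \<le> (\<Sum>l\<in>UNIV. \<bar>A $ i $ l\<bar> * \<bar>mat_pow A k $ l $ j\<bar>)"
    by (simp add: matrix_matrix_mult_def abs_mult[symmetric] sum_abs)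
  also have "\<dots> \<le> (\<Sum>l\<in>UNIV. \<bar>A $ i $ l\<bar> * ?c ^ k)"
    by (intro sum_mono mult_left_mono Suc) auto
  also have "\<dots> = (\<Sum>l\<in>UNIV. \<bar>A $ i $ l\<bar>) * ?c ^ k"
    by (simp add: sum_distrib_right)
  also have "\<dots> \<le> ?c * ?c ^ k"
    by (intro mult_right_mono zero_le_power c
        member_le_sum[where f = "\<lambda>i. \<Sum>l\<in>UNIV. \<bar>A $ i $ l\<bar>"] sum_nonneg) auto
  finally show ?case by simp
qed

lemma summable_mat_exp:
  fixes Q :: "real^'n^'n"
  shows "summable (\<lambda>k. (1 / fact k) *\<^sub>R mat_pow Q k)"
proof -
  define c where "c = (\<Sum>i\<in>UNIV. \<Sum>j\<in>UNIV. \<bar>Q $ i $ j\<bar>)"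
  define d where "d = real CARD('n) * real CARD('n)"
  have *: "norm (mat_pow Q k) \<le> d * c ^ k" for k
  proof -
    have "norm (mat_pow Q k) \<le> (\<Sum>i\<in>UNIV. norm (mat_pow Q k $ i))"
      by (rule norm_le_l1_cart[THEN order_trans, rotated] | simp add: norm_vec_def L2_set_le_sum)+
    also have "\<dots> \<le> (\<Sum>i\<in>(UNIV::'n set). \<Sum>j\<in>(UNIV::'n set). c ^ k)"
      using mat_pow_entry_bound[of Q k]
      by (intro sum_mono order_trans[OF norm_le_l1_cart]) (simp add: c_def)
    finally show ?thesis by (simp add: d_def)
  qed
  have "summable (\<lambda>k. d * (inverse (fact k) * c ^ k))"
    by (intro summable_mult summable_exp)
  then show ?thesis
    by (rule summable_comparison_test')
      (use * in \<open>simp add: field_simps divide_right_mono\<close>)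
qed

definition real_logarithm :: "real^'n^'n \<Rightarrow> real^'n^'n \<Rightarrow> bool" where
  "real_logarithm R M \<longleftrightarrow> M = mat_exp R"

definition eigenvalues :: "real^'n^'n \<Rightarrow> complex set" where
  "eigenvalues M = {c. \<exists>v. v \<noteq> 0 \<and> map_matrix complex_of_real M *v v = c *s v}"

text \<open>All eigenvalues, counted with algebraic multiplicity, are distinct: there are as many
  eigenvalues in the complex plane as the dimension.\<close>

definition simple_spectrum :: "real^'n^'n \<Rightarrow> bool" where
  "simple_spectrum M \<longleftrightarrow> card (eigenvalues M) = CARD('n)"

definition CM_matrix :: "real^('s::finite set)^('s set) \<Rightarrow> bool" where
  "CM_matrix M \<longleftrightarrow>
    (\<exists>p :: 's set \<Rightarrow> real.
       (\<forall>K. 0 \<le> p K) \<and> (\<Sum>K\<in>UNIV. p K) = 1 \<and>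
       (\<forall>I J. M $ I $ J = (\<Sum>K | I \<union> K = J. p K)))"

text \<open>Only the values of \<open>r\<close> at non-empty sets matter; these form the parameter vector.\<close>

definition property_CG :: "real^('s::finite set)^('s set) \<Rightarrow> ('s set \<Rightarrow> real) \<Rightarrow> bool" where
  "property_CG B r \<longleftrightarrow>
    (\<forall>I J. \<not> I \<subseteq> J \<longrightarrow> B $ I $ J = 0) \<and>
    (\<forall>I. (\<Sum>J\<in>UNIV. B $ I $ J) = 0) \<and>
    (\<forall>I J. I \<noteq> J \<longrightarrow> B $ I $ J = (\<Sum>K | K \<noteq> {} \<and> I \<union> K = J. r K)) \<and>
    (\<forall>I. B $ I $ I = - (\<Sum>J | I \<subset> J. B $ I $ J))"

definition markov_generator :: "real^'n^'n \<Rightarrow> bool" where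
  "markov_generator Q \<longleftrightarrow>
    (\<forall>i j. i \<noteq> j \<longrightarrow> 0 \<le> Q $ i $ j) \<and> (\<forall>i. (\<Sum>j\<in>UNIV. Q $ i $ j) = 0)"

definition embeddable :: "real^'n^'n \<Rightarrow> bool" where
  "embeddable M \<longleftrightarrow> (\<exists>Q. markov_generator Q \<and> M = mat_exp Q)"

lemma CM_matrix_upper:
  assumes "CM_matrix M" "\<not> I \<subseteq> J"
  shows "M $ I $ J = 0"
proof -
  have "{K. I \<union> K = J} = {}" using assms(2) by auto
  then show ?thesis using assms(1) by (auto simp: CM_matrix_def)
qed

lemma CM_matrix_eigenvalues:
  fixes M :: "real^('s::finite set)^('s set)"
  assumes "CM_matrix M"
  shows "eigenvalues M = range (\<lambda>K. complex_of_real (M $ K $ K))"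
proof (intro equalityI subsetI)
  fix c assume "c \<in> eigenvalues M"
  then obtain v where v: "v \<noteq> 0" "map_matrix complex_of_real M *v v = c *s v"
    by (auto simp: eigenvalues_def)
  have "finite {I. v $ I \<noteq> 0}" "{I. v $ I \<noteq> 0} \<noteq> {}"
    using v(1) by (auto simp: vec_eq_iff)
  then obtain I where I: "v $ I \<noteq> 0" and max: "\<And>J. I \<subset> J \<Longrightarrow> v $ J = 0"
    using finite_has_maximal[of "{I. v $ I \<noteq> 0}"] by (metis (mono_tags) mem_Collect_eq psubset_eq)
  have "c * v $ I = (\<Sum>J\<in>UNIV. complex_of_real (M $ I $ J) * v $ J)"
    using arg_cong[OF v(2), of "\<lambda>x. x $ I"] by (simp add: matrix_vector_mult_def map_matrix_def)
  also have "\<dots> = (\<Sum>J\<in>{I}. complex_of_real (M $ I $ J) * v $ J)"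
    using max CM_matrix_upper[OF assms] by (intro sum.mono_neutral_right) auto
  finally have "c = complex_of_real (M $ I $ I)" using I by simp
  then show "c \<in> range (\<lambda>K. complex_of_real (M $ K $ K))" by auto
next
  fix c assume "c \<in> range (\<lambda>K. complex_of_real (M $ K $ K))"
  then obtain K where c: "c = complex_of_real (M $ K $ K)" by auto
  obtain p where p: "\<And>I J. M $ I $ J = (\<Sum>L | I \<union> L = J. p L)"
    using assms by (auto simp: CM_matrix_def)
  define v :: "complex^('s set)" where "v = (\<chi> J. if J \<subseteq> K then 1 else 0)"
  have M: "M $ I $ J = (\<Sum>L\<in>UNIV. if I \<union> L = J then p L else 0)" for I J
    unfolding p by (simp add: sum.If_cases)
  have row: "(\<Sum>J | J \<subseteq> K. M $ I $ J) = (if I \<subseteq> K then M $ K $ K else 0)" for I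
  proof -
    have "(\<Sum>J | J \<subseteq> K. M $ I $ J) = (\<Sum>L\<in>UNIV. \<Sum>J | J \<subseteq> K. if I \<union> L = J then p L else 0)"
      unfolding M by (rule sum.swap)
    also have "\<dots> = (\<Sum>L\<in>UNIV. if I \<subseteq> K then if K \<union> L = K then p L else 0 else 0)"
      by (intro sum.cong refl) (auto simp: sum.delta)
    also have "\<dots> = (if I \<subseteq> K then M $ K $ K else 0)" by (simp add: M)
    finally show ?thesis .
  qed
  have "map_matrix complex_of_real M *v v = c *s v"
  proof (subst vec_eq_iff, intro allI)
    fix I
    have "(map_matrix complex_of_real M *v v) $ I
        = (\<Sum>J\<in>UNIV. if J \<subseteq> K then complex_of_real (M $ I $ J) else 0)"
      by (auto simp: matrix_vector_mult_def map_matrix_def v_def intro!: sum.cong)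
    also have "\<dots> = complex_of_real (\<Sum>J | J \<subseteq> K. M $ I $ J)"
      by (simp add: sum.If_cases)
    finally show "(map_matrix complex_of_real M *v v) $ I = (c *s v) $ I"
      by (simp add: row v_def c)
  qed
  moreover have "v $ K \<noteq> 0" by (simp add: v_def)
  then have "v \<noteq> 0" by (metis zero_index)
  ultimately show "c \<in> eigenvalues M" by (auto simp: eigenvalues_def)
qed

lemma CM_matrix_simple_spectrum_iff:
  assumes "CM_matrix M"
  shows "simple_spectrum M \<longleftrightarrow> inj (\<lambda>K. M $ K $ K)"
proof -
  have "simple_spectrum M \<longleftrightarrow> inj (\<lambda>K. complex_of_real (M $ K $ K))"
    unfolding simple_spectrum_def CM_matrix_eigenvalues[OF assms]
    using inj_on_iff_eq_card[OF finite_class.finite_UNIV] by (rule sym)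
  then show ?thesis by (simp add: inj_on_def)
qed

end

theory Submission
  imports Defs
begin

text \<open>
  The zeta matrix \<open>Z\<close> of the subset lattice diagonalises every matrix of the form
  \<open>B\<^sub>I\<^sub>J = (\<Sum>K | I \<union> K = J. q K)\<close> simultaneously, with eigenvalues \<open>\<Sum>L\<subseteq>K. q L\<close>.
  For a non-singular CM matrix these lie in \<open>(0, 1]\<close>, so the logarithmic series converges on each of
  them, and \<open>R = Z diag(\<mu>) Z\<^sup>-\<^sup>1\<close>. By Moebius inversion \<open>R\<close> comes from the vector \<open>r\<close>
  in the same way as \<open>M\<close> comes from \<open>p\<close>, which is Property CG. If the spectrum is simple, a real logarithm commutes
  with \<open>M\<close>, hence is itself diagonalised by \<open>Z\<close>, and its real eigenvalues are forced to be \<open>\<mu>\<close>.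
\<close>

section \<open>Diagonal matrices and basic matrix algebra\<close>

definition diag_mat :: "('n \<Rightarrow> real) \<Rightarrow> real^'n^'n" where
  "diag_mat d = (\<chi> i j. if i = j then d i else 0)"

lemma matrix_eqI:
  assumes "\<And>i j. A $ i $ j = B $ i $ j"
  shows "A = B"
  using assms by (simp add: vec_eq_iff)

lemma matrix_mul_diag_mat [simp]: "(X ** diag_mat d) $ i $ j = X $ i $ j * d j"
  by (simp add: matrix_matrix_mult_def diag_mat_def if_distrib sum.If_cases cong: if_cong)

lemma diag_mat_matrix_mul [simp]: "(diag_mat d ** X) $ i $ j = d i * X $ i $ j"
  by (simp add: matrix_matrix_mult_def diag_mat_def if_distrib if_distribR sum.If_cases cong: if_cong)

lemma diag_mat_mult: "diag_mat d ** diag_mat e = diag_mat (\<lambda>i. d i * e i)"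
  by (simp add: vec_eq_iff) (simp add: diag_mat_def)

lemma diag_mat_one: "diag_mat (\<lambda>_. 1) = mat 1"
  by (simp add: diag_mat_def mat_def)

lemma diag_mat_minus_one: "diag_mat (\<lambda>i. d i - 1) = diag_mat d - mat 1"
  by (simp add: diag_mat_def mat_def vec_eq_iff)

lemma diag_mat_inject: "diag_mat d = diag_mat e \<longleftrightarrow> d = e"
  by (auto simp: diag_mat_def vec_eq_iff fun_eq_iff)

lemma scaleR_diag_mat: "c *\<^sub>R diag_mat d = diag_mat (\<lambda>i. c * d i)"
  by (simp add: diag_mat_def vec_eq_iff)

text \<open>Continuity of two-sided multiplication lets a convergent matrix series be conjugated or
  multiplied term by term.\<close>

lemma bounded_linear_matrix_mul_both:
  fixes A :: "real^'n^'m" and B :: "real^'q^'p"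
  shows "bounded_linear (\<lambda>X. A ** X ** B)"
proof -
  have "(A ** (X + Y)) ** B = A ** X ** B + A ** Y ** B" for X Y :: "real^'p^'n"
    by (simp add: matrix_add_ldistrib matrix_matrix_mult_def vec_eq_iff distrib_right sum.distrib
        distrib_left)
  then show ?thesis
    by (intro linear_conv_bounded_linear[THEN iffD1] linearI)
      (simp_all add: matrix_scalar_ac flip: scalar_matrix_assoc)
qed

lemma matrix_diff_ldistrib: "(A :: real^'n^'m) ** (B - C) = A ** B - A ** C"
  by (simp add: matrix_matrix_mult_def vec_eq_iff right_diff_distrib sum_subtractf)

lemma matrix_diff_rdistrib: "((A :: real^'n^'m) - B) ** C = A ** C - B ** C"
  by (simp add: matrix_matrix_mult_def vec_eq_iff left_diff_distrib sum_subtractf)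

lemma sums_diag_mat:
  assumes "\<And>i. (\<lambda>k. d k i) sums e i"
  shows "(\<lambda>k. diag_mat (d k)) sums diag_mat e"
  unfolding sums_def
proof (intro vec_tendstoI)
  fix i j
  show "(\<lambda>n. (\<Sum>k<n. diag_mat (d k)) $ i $ j) \<longlonglongrightarrow> diag_mat e $ i $ j"
    using assms[of i] by (cases "i = j") (simp_all add: diag_mat_def sums_def)
qed

lemma mat_pow_diagonalised:
  assumes "Z ** W = mat 1" "W ** Z = mat 1"
  shows "mat_pow (Z ** diag_mat d ** W) k = Z ** diag_mat (\<lambda>i. d i ^ k) ** W"
proof (induction k)
  case 0
  then show ?case by (simp add: diag_mat_one assms)
next
  case (Suc k)
  have "mat_pow (Z ** diag_mat d ** W) (Suc k)
      = Z ** diag_mat d ** (W ** Z) ** diag_mat (\<lambda>i. d i ^ k) ** W"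
    by (simp only: mat_pow.simps Suc.IH matrix_mul_assoc)
  also have "\<dots> = Z ** (diag_mat d ** diag_mat (\<lambda>i. d i ^ k)) ** W"
    by (simp add: assms matrix_mul_assoc)
  finally show ?case by (simp add: diag_mat_mult)
qed

text \<open>Reduces a matrix power series to scalar series at the eigenvalues. The exponent
  \<open>f\<close> is the identity for the exponential and \<open>Suc\<close> for the
  logarithm.\<close>

lemma sums_mat_pow_diagonalised:
  assumes "Z ** W = mat 1" "W ** Z = mat 1"
    and "\<And>i. (\<lambda>k. c k * d i ^ f k) sums e i"
  shows "(\<lambda>k. c k *\<^sub>R mat_pow (Z ** diag_mat d ** W) (f k)) sums (Z ** diag_mat e ** W)"
proof -
  have "(\<lambda>k. Z ** diag_mat (\<lambda>i. c k * d i ^ f k) ** W) sums (Z ** diag_mat e ** W)"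
    by (intro bounded_linear.sums[OF bounded_linear_matrix_mul_both] sums_diag_mat assms(3))
  then show ?thesis
    by (simp add: mat_pow_diagonalised[OF assms(1,2)] matrix_scalar_ac scalar_matrix_assoc
        flip: scaleR_diag_mat)
qed

lemma mat_exp_diagonalised:
  assumes "Z ** W = mat 1" "W ** Z = mat 1"
  shows "mat_exp (Z ** diag_mat d ** W) = Z ** diag_mat (\<lambda>i. exp (d i)) ** W"
proof -
  have "(\<lambda>k. (1 / fact k) * d i ^ k) sums exp (d i)" for i
    using exp_converges[of "d i"] by (simp add: divide_inverse)
  from sums_mat_pow_diagonalised[OF assms this] show ?thesis
    by (simp add: mat_exp_def sums_iff)
qed

section \<open>Commutation and uniqueness of real logarithms\<close>

lemma mat_pow_commute: "mat_pow X k ** X = X ** mat_pow X k"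
  by (induction k) (simp_all add: matrix_mul_assoc[symmetric])

lemma mat_exp_commute: "mat_exp X ** X = X ** mat_exp X"
proof -
  have s: "(\<lambda>k. (1 / fact k) *\<^sub>R mat_pow X k) sums mat_exp X"
    using summable_mat_exp[of X] by (simp add: mat_exp_def summable_sums)
  have "(\<lambda>k. (1 / fact k) *\<^sub>R (X ** mat_pow X k)) sums (mat_exp X ** X)"
    using bounded_linear.sums[OF bounded_linear_matrix_mul_both[of "mat 1" X] s]
    by (simp add: mat_pow_commute flip: scalar_matrix_assoc)
  moreover have "(\<lambda>k. (1 / fact k) *\<^sub>R (X ** mat_pow X k)) sums (X ** mat_exp X)"
    using bounded_linear.sums[OF bounded_linear_matrix_mul_both[of X "mat 1"] s]
    by (simp add: matrix_scalar_ac flip: scalar_matrix_assoc)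
  ultimately show ?thesis by (rule sums_unique2)
qed

text \<open>Comparing entries gives \<open>X $ i $ j * (d j - d i) = 0\<close>, which kills every
  off-diagonal entry when the \<open>d i\<close> are distinct.\<close>

lemma commute_diag_mat_imp_diag:
  assumes "X ** diag_mat d = diag_mat d ** X" "inj d"
  shows "X = diag_mat (\<lambda>i. X $ i $ i)"
proof -
  have "X $ i $ j * d j = d i * X $ i $ j" for i j
    using arg_cong[OF assms(1), of "\<lambda>Y. Y $ i $ j"] by simp
  then show ?thesis
    using assms(2) by (auto simp: vec_eq_iff diag_mat_def inj_eq)
qed

text \<open>\<open>X\<close> commutes with its exponential, so in the eigenbasis it commutes with a
  diagonal matrix with distinct entries and is diagonal itself.\<close>

lemma real_logarithm_unique:
  fixes X Z W :: "real^'n^'n"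
  assumes ZW: "Z ** W = mat 1" "W ** Z = mat 1" and "inj d"
    and X: "mat_exp X = Z ** diag_mat d ** W"
  shows "X = Z ** diag_mat (\<lambda>i. ln (d i)) ** W"
proof -
  define Q where "Q = W ** X ** Z"
  have W_Z: "W ** (Z ** Y) = Y" and Z_W: "Z ** (W ** Y) = Y" for Y :: "real^'n^'n"
    by (simp_all add: ZW matrix_mul_assoc)
  have X_eq: "X = Z ** Q ** W"
    by (simp add: Q_def Z_W ZW flip: matrix_mul_assoc)
  have "Z ** diag_mat d ** W ** X = X ** (Z ** diag_mat d ** W)"
    using mat_exp_commute[of X] by (simp add: X)
  from arg_cong[OF this, of "\<lambda>Y. W ** Y ** Z"] have "Q ** diag_mat d = diag_mat d ** Q"
    by (simp add: Q_def W_Z ZW flip: matrix_mul_assoc)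
  then obtain q where q: "Q = diag_mat q"
    using commute_diag_mat_imp_diag \<open>inj d\<close> by blast
  have "Z ** diag_mat (\<lambda>i. exp (q i)) ** W = Z ** diag_mat d ** W"
    using X by (simp add: X_eq q mat_exp_diagonalised[OF ZW])
  from arg_cong[OF this, of "\<lambda>Y. W ** Y ** Z"] have "(\<lambda>i. exp (q i)) = d"
    by (simp add: W_Z ZW diag_mat_inject flip: matrix_mul_assoc)
  \<comment> \<open>Since \<open>q\<close> is real, \<open>exp\<close> is injective here; no
    multiples of 2 pi i can appear.\<close>
  then have "q = (\<lambda>i. ln (d i))" by auto
  then show ?thesis by (simp add: X_eq q)
qed

section \<open>Zeta and Moebius matrices of the subset lattice\<close>

definition zeta_mat :: "real^('s::finite set)^('s set)" where
  "zeta_mat = (\<chi> I J. if I \<subseteq> J then 1 else 0)"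

text \<open>The sign is the Moebius function of the subset lattice, -1 to the power
  \<open>card (J - I)\<close>, written as a product so that the factor depending on \<open>J\<close>
  can leave a sum.\<close>

definition moebius_mat :: "real^('s::finite set)^('s set)" where
  "moebius_mat = (\<chi> I J. if I \<subseteq> J then (-1) ^ card I * (-1) ^ card J else 0)"

text \<open>For \<open>I \<subset> J\<close>, the interval between them has as many sets of even as
  of odd cardinality, so the signs cancel.\<close>

lemma zeta_moebius: "zeta_mat ** moebius_mat = (mat 1 :: real^('s::finite set)^('s set))"
proof (rule matrix_eqI)
  fix I J :: "'s set"
  have "(zeta_mat ** moebius_mat) $ I $ J
      = (\<Sum>K\<in>UNIV. if K \<subseteq> J \<and> I \<subseteq> K then (-1) ^ card K * (-1) ^ card J else 0 :: real)"
    by (auto simp: matrix_matrix_mult_def zeta_mat_def moebius_mat_def intro!: sum.cong)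
  also have "\<dots> = (\<Sum>K | K \<subseteq> J \<and> I \<subseteq> K. (-1) ^ card K) * (-1) ^ card J"
    by (simp add: sum.If_cases sum_distrib_right)
  also have "\<dots> = (if I = J then 1 else 0)"
  proof -
    consider "\<not> I \<subseteq> J" | "I = J" | "I \<subset> J" by blast
    then show ?thesis
    proof cases
      case 1
      then have "{K. K \<subseteq> J \<and> I \<subseteq> K} = {}" "I \<noteq> J" by auto
      then show ?thesis by (simp only: sum.empty) simp
    next
      case 2
      then have "{K. K \<subseteq> J \<and> I \<subseteq> K} = {J}" by auto
      with 2 show ?thesis by (simp flip: power_add)
    next
      case 3
      then have "(\<Sum>K | K \<subseteq> J \<and> I \<subseteq> K. (-1) ^ card K) = (0 :: real)"
        by (intro sum_alternating_cancels) (simp_all add: card_subsupersets_even_odd)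
      with 3 show ?thesis by (simp add: psubset_eq)
    qed
  qed
  finally show "(zeta_mat ** moebius_mat) $ I $ J = (mat 1 :: real^('s set)^('s set)) $ I $ J"
    by (simp add: mat_def)
qed

lemma moebius_zeta: "moebius_mat ** zeta_mat = (mat 1 :: real^('s::finite set)^('s set))"
  using zeta_moebius matrix_left_right_inverse by blast

text \<open>As \<open>I \<union> L \<subseteq> K\<close> splits into \<open>I \<subseteq> K\<close>
  and \<open>L \<subseteq> K\<close>, the columns of \<open>zeta_mat\<close> are eigenvectors of
  \<open>B\<close>, whatever \<open>q\<close> is.\<close>

lemma union_matrix_diagonalised:
  fixes B :: "real^('s::finite set)^('s set)"
  assumes B: "\<And>I J. B $ I $ J = (\<Sum>K | I \<union> K = J. q K)"
  shows "B = zeta_mat ** diag_mat (\<lambda>K. \<Sum>L | L \<subseteq> K. q L) ** moebius_mat"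
proof -
  have "B ** zeta_mat = zeta_mat ** diag_mat (\<lambda>K. \<Sum>L | L \<subseteq> K. q L)"
  proof (rule matrix_eqI)
    fix I K
    have "(B ** zeta_mat) $ I $ K
        = (\<Sum>J\<in>UNIV. \<Sum>L\<in>UNIV. if I \<union> L = J then if J \<subseteq> K then q L else 0 else 0)"
      unfolding matrix_matrix_mult_def zeta_mat_def
      by (auto simp: B sum.If_cases intro!: sum.cong)
    also have "\<dots> = (\<Sum>L\<in>UNIV. if I \<union> L \<subseteq> K then q L else 0)"
      by (subst sum.swap) simp
    also have "\<dots> = (if I \<subseteq> K then \<Sum>L | L \<subseteq> K. q L else 0)"
      by (simp add: sum.If_cases)
    finally show "(B ** zeta_mat) $ I $ K
        = (zeta_mat ** diag_mat (\<lambda>K. \<Sum>L | L \<subseteq> K. q L)) $ I $ K"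
      by (simp add: zeta_mat_def)
  qed
  then have "B ** (zeta_mat ** moebius_mat)
      = zeta_mat ** diag_mat (\<lambda>K. \<Sum>L | L \<subseteq> K. q L) ** moebius_mat"
    by (simp add: matrix_mul_assoc)
  then show ?thesis by (simp add: zeta_moebius)
qed

text \<open>Moebius inversion, used to recover the logarithms of the eigenvalues from the parameter
  vector.\<close>

lemma sum_moebius_transform:
  fixes f :: "'s::finite set \<Rightarrow> real"
  shows "(\<Sum>L | L \<subseteq> K. (-1) ^ card L * (\<Sum>H | H \<subseteq> L. (-1) ^ card H * f H)) = f K"
  using inclusion_exclusion_symmetric[of "\<lambda>L. \<Sum>H | H \<subseteq> L. (-1) ^ card H * f H" f K]
  by (simp add: Pow_def)

lemma invertible_diagonalised_nonzero:
  assumes "invertible (Z ** diag_mat d ** W)" "Z ** W = mat 1" "W ** Z = mat 1"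
  shows "d i \<noteq> 0"
proof -
  have "invertible (diag_mat d)"
  proof -
    have "W ** (Z ** diag_mat d ** W) ** Z = W ** Z ** diag_mat d ** (W ** Z)"
      by (simp only: matrix_mul_assoc)
    moreover have "invertible W" "invertible Z"
      using assms(2,3) by (auto simp: invertible_def)
    ultimately show ?thesis
      using assms by (metis invertible_mult matrix_mul_lid matrix_mul_rid)
  qed
  then obtain Y where "diag_mat d ** Y = mat 1" by (auto simp: invertible_def)
  from arg_cong[OF this, of "\<lambda>X. X $ i $ i"] show ?thesis by (auto simp: mat_def)
qed

section \<open>Property CG and Markov generators\<close>

text \<open>The value \<open>r {}\<close> enters only the diagonal of \<open>B\<close>. That all of
  \<open>r\<close> sums to zero is exactly what makes the row sums vanish.\<close>

lemma property_CG_union_matrix: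
  fixes B :: "real^('s::finite set)^('s set)"
  assumes B: "\<And>I J. B $ I $ J = (\<Sum>K | I \<union> K = J. r K)" and r: "(\<Sum>K\<in>UNIV. r K) = 0"
  shows "property_CG B r"
proof -
  have upper: "B $ I $ J = 0" if "\<not> I \<subseteq> J" for I J
  proof -
    have "{K. I \<union> K = J} = {}" using that by auto
    then show ?thesis by (simp only: B sum.empty)
  qed
  have row: "(\<Sum>J\<in>UNIV. B $ I $ J) = 0" for I
  proof -
    have "(\<Sum>J\<in>UNIV. B $ I $ J) = (\<Sum>J\<in>UNIV. \<Sum>K\<in>UNIV. if I \<union> K = J then r K else 0)"
      by (simp add: B sum.If_cases)
    also have "\<dots> = (\<Sum>K\<in>UNIV. r K)"
      by (subst sum.swap) simp
    finally show ?thesis by (simp add: r)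
  qed
  have "B $ I $ I = - (\<Sum>J | I \<subset> J. B $ I $ J)" for I
  proof -
    have "(\<Sum>J\<in>UNIV. B $ I $ J) = (\<Sum>J\<in>insert I {J. I \<subset> J}. B $ I $ J)"
    proof (rule sum.mono_neutral_right)
      show "\<forall>J\<in>UNIV - insert I {J. I \<subset> J}. B $ I $ J = 0"
        using upper by (metis DiffD2 insertCI mem_Collect_eq psubsetI)
    qed simp_all
    then show ?thesis by (simp add: row)
  qed
  moreover have "B $ I $ J = (\<Sum>K | K \<noteq> {} \<and> I \<union> K = J. r K)" if "I \<noteq> J" for I J
    unfolding B using that by (intro sum.cong) auto
  ultimately show ?thesis
    using upper row by (simp add: property_CG_def)
qed

text \<open>Off the diagonal, the row of \<open>B\<close> at the empty set is \<open>r\<close>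
  itself, and all other rows consist of sums of entries of \<open>r\<close>.\<close>

lemma property_CG_markov_generator_iff:
  assumes "property_CG B r"
  shows "markov_generator B \<longleftrightarrow> (\<forall>K. K \<noteq> {} \<longrightarrow> 0 \<le> r K)"
proof
  assume gen: "markov_generator B"
  show "\<forall>K. K \<noteq> {} \<longrightarrow> 0 \<le> r K"
  proof (intro allI impI)
    fix K assume "K \<noteq> ({} :: 'a set)"
    then have "{L. L \<noteq> {} \<and> {} \<union> L = K} = {K}" by auto
    moreover have "B $ {} $ K = (\<Sum>L | L \<noteq> {} \<and> {} \<union> L = K. r L)"
      using assms \<open>K \<noteq> {}\<close> unfolding property_CG_def by metis
    ultimately have "B $ {} $ K = r K"
      by (simp only: sum.insert sum.empty) simp
    with gen \<open>K \<noteq> {}\<close> show "0 \<le> r K" by (metis markov_generator_def)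
  qed
next
  assume nonneg: "\<forall>K. K \<noteq> {} \<longrightarrow> 0 \<le> r K"
  have "0 \<le> B $ I $ J" if "I \<noteq> J" for I J
  proof -
    have "B $ I $ J = (\<Sum>K | K \<noteq> {} \<and> I \<union> K = J. r K)"
      using assms that unfolding property_CG_def by metis
    also have "\<dots> \<ge> 0"
      by (rule sum_nonneg) (use nonneg in blast)
    finally show ?thesis .
  qed
  moreover have "(\<Sum>J\<in>UNIV. B $ I $ J) = 0" for I
    using assms unfolding property_CG_def by metis
  ultimately show "markov_generator B"
    unfolding markov_generator_def by blast
qed

lemma log_one_plus_series_sums:
  fixes x :: real
  assumes "0 < x" "x \<le> 1"
  shows "(\<lambda>k. (-1) ^ k / real (Suc k) * (x - 1) ^ Suc k) sums ln x"
proof -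
  have "(\<lambda>n. - ((- (x - 1)) ^ n) / of_nat n) sums ln (1 + (x - 1))"
    using assms by (intro ln_series') auto
  then have "(\<lambda>k. - ((- (x - 1)) ^ Suc k) / of_nat (Suc k)) sums ln x"
    by (subst sums_Suc_iff) simp
  then show ?thesis
    by (simp only: power_minus[of "x - 1"]) simp
qed

section \<open>The principal logarithm of a CM matrix\<close>

theorem theorem4p7:
  fixes M A R :: "real^('s::finite set)^('s set)"
    and lam \<mu> r :: "'s set \<Rightarrow> real"
  assumes CM: "CM_matrix M"
    and nonsingular: "invertible M"
  defines "A \<equiv> M - mat 1"
    and "lam \<equiv> \<lambda>K. M $ K $ K"
    and "\<mu> \<equiv> \<lambda>I. ln (lam I)"
    and "r \<equiv> \<lambda>K. \<Sum>H | H \<noteq> {} \<and> - K \<subseteq> H. (-1) ^ card (H - (- K)) * \<mu> (- H)"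
    and "R \<equiv> \<Sum>k. ((-1) ^ k / real (Suc k)) *\<^sub>R mat_pow A (Suc k)"
  shows "summable (\<lambda>k. ((-1) ^ k / real (Suc k)) *\<^sub>R mat_pow A (Suc k))
    \<and> real_logarithm R M
    \<and> property_CG R r
    \<and> (markov_generator R \<longleftrightarrow> (\<forall>K. K \<noteq> {} \<longrightarrow> 0 \<le> r K))
    \<and> (markov_generator R \<longrightarrow> embeddable M)
    \<and> (simple_spectrum M \<longrightarrow>
         (\<forall>R'. real_logarithm R' M \<longrightarrow> R' = R)
         \<and> (embeddable M \<longleftrightarrow> markov_generator R))"
proof -
  define Z W :: "real^('s set)^('s set)" where "Z = zeta_mat" and "W = moebius_mat"
  have ZW: "Z ** W = mat 1" "W ** Z = mat 1"
    by (simp_all add: Z_def W_def zeta_moebius moebius_zeta)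
  obtain p where p: "\<And>K. 0 \<le> p K" "(\<Sum>K\<in>UNIV. p K) = 1"
    and Mp: "\<And>I J. M $ I $ J = (\<Sum>K | I \<union> K = J. p K)"
    using CM by (auto simp: CM_matrix_def)
  have lam: "lam K = (\<Sum>L | L \<subseteq> K. p L)" for K
  proof -
    have "{L. K \<union> L = K} = {L. L \<subseteq> K}" by auto
    then show ?thesis by (simp add: lam_def Mp)
  qed
  have M: "M = Z ** diag_mat lam ** W"
    using union_matrix_diagonalised[OF Mp] by (simp add: Z_def W_def lam[abs_def])
  \<comment> \<open>Each eigenvalue is a partial sum of \<open>p\<close>, hence non-negative;
    non-singularity excludes 0. With the bound 1 this gives convergence of the logarithmic
    series.\<close>
  have lam_pos: "0 < lam K" for K
    using invertible_diagonalised_nonzero[OF nonsingular[unfolded M] ZW, of K]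
      sum_nonneg[of "{L. L \<subseteq> K}" p] p(1) lam[of K] by (simp add: less_le)
  have lam_le_1: "lam K \<le> 1" for K
    using sum_mono2[of UNIV "{L. L \<subseteq> K}" p] p by (simp add: lam)
  have \<mu>_UNIV: "\<mu> UNIV = 0"
    using p(2) by (simp add: \<mu>_def lam)

  have A: "A = Z ** diag_mat (\<lambda>K. lam K - 1) ** W"
    by (simp add: A_def M diag_mat_minus_one matrix_diff_ldistrib matrix_diff_rdistrib ZW)
  have series: "(\<lambda>k. ((-1) ^ k / real (Suc k)) *\<^sub>R mat_pow A (Suc k)) sums (Z ** diag_mat \<mu> ** W)"
    unfolding A \<mu>_def
    by (intro sums_mat_pow_diagonalised[OF ZW, where f = Suc] log_one_plus_series_sums
        lam_pos lam_le_1)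
  then have R: "R = Z ** diag_mat \<mu> ** W"
    by (simp add: R_def sums_iff)
  have log: "real_logarithm R M"
    by (simp add: real_logarithm_def R mat_exp_diagonalised[OF ZW] \<mu>_def lam_pos M)

  have r: "r K = (-1) ^ card K * (\<Sum>H | H \<subseteq> K. (-1) ^ card H * \<mu> H)" for K
  proof -
    \<comment> \<open>Complementing \<open>H\<close> turns \<open>H \<noteq> {}\<close> into
      \<open>H \<noteq> UNIV\<close>; the missing term can then be added because
      \<open>\<mu> UNIV = 0\<close>.\<close>
    have "r K = (\<Sum>H | H \<noteq> UNIV \<and> H \<subseteq> K. (-1) ^ card (K - H) * \<mu> H)"
      unfolding r_def
      by (rule sum.reindex_bij_witness[of _ uminus uminus])
        (auto simp: Diff_eq Int_commute)
    also have "\<dots> = (\<Sum>H | H \<subseteq> K. (-1) ^ card (K - H) * \<mu> H)"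
      by (intro sum.mono_neutral_left) (auto simp: \<mu>_UNIV)
    also have "\<dots> = (\<Sum>H | H \<subseteq> K. (-1) ^ card K * ((-1) ^ card H * \<mu> H))"
    proof (intro sum.cong refl)
      fix H assume "H \<in> {H. H \<subseteq> K}"
      then have "(-1) ^ card (K - H) = ((-1) ^ card K * (-1) ^ card H :: real)"
        by (simp add: card_Diff_subset card_mono neg_one_power_add_eq_neg_one_power_diff
            flip: power_add)
      then show "(-1) ^ card (K - H) * \<mu> H = (-1) ^ card K * ((-1) ^ card H * \<mu> H)" by simp
    qed
    finally show ?thesis by (simp add: sum_distrib_left)
  qed
  have \<mu>_eq: "(\<Sum>L | L \<subseteq> K. r L) = \<mu> K" for K
    unfolding r by (rule sum_moebius_transform)
  \<comment> \<open>The union matrix built from \<open>r\<close> has the same eigenvectors as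
    \<open>R\<close> and, by the inversion above, the same eigenvalues \<open>\<mu>\<close>, so it
    equals \<open>R\<close>.\<close>
  define B :: "real^('s set)^('s set)" where "B = (\<chi> I J. \<Sum>K | I \<union> K = J. r K)"
  have B: "B $ I $ J = (\<Sum>K | I \<union> K = J. r K)" for I J
    by (simp add: B_def)
  have "B = R"
    using union_matrix_diagonalised[of B, OF B] by (simp add: R Z_def W_def \<mu>_eq)
  then have CG: "property_CG R r"
    \<comment> \<open>At \<open>UNIV\<close> the inversion says that the total of \<open>r\<close>
      is \<open>\<mu> UNIV = 0\<close>.\<close>
    using property_CG_union_matrix[of B, OF B] \<mu>_eq[of UNIV] \<mu>_UNIV by simp

  have unique: "R' = R" if "simple_spectrum M" "real_logarithm R' M" for R'
  proof -
    have "inj lam"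
      using that(1) CM_matrix_simple_spectrum_iff[OF CM] by (simp add: lam_def)
    moreover have "mat_exp R' = Z ** diag_mat lam ** W"
      using that(2) M by (simp add: real_logarithm_def)
    ultimately show ?thesis
      using real_logarithm_unique[OF ZW] by (simp add: R \<mu>_def)
  qed
  have embeddable: "markov_generator R \<Longrightarrow> embeddable M"
    using log by (auto simp: embeddable_def real_logarithm_def)
  \<comment> \<open>A generator that embeds \<open>M\<close> is a real logarithm of
    \<open>M\<close>, so uniqueness identifies it with \<open>R\<close>.\<close>
  have generator: "markov_generator R" if "simple_spectrum M" "embeddable M"
    using that unique by (auto simp: embeddable_def real_logarithm_def)
  show ?thesis
    by (intro conjI impI allI property_CG_markov_generator_iff[OF CG] iffI[OF generator embeddable])
      (fact sums_summable[OF series] log CG embeddable unique | assumption)+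
qed

end
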